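(* Let $m \in \mathbb{N}$ and $a = (a_1,\dots,a_m) \in \mathbb{N}^m$ with $a_j \ge 2$ for all $j \in \{1,\dots,m\}$. Then the number $N_a$ of different joint ordered factorisations of $a$ is $$N_a = \sum_{l \in \mathbb{N}^m} \binom{|l|}{l} \prod_{j=1}^m c_{l_j}^{(-l_j)}(a_j),$$ where the sum has only finitely many nonzero terms.
   Context: A joint ordered factorisation of $a \in \mathbb{N}^m$ is a tuple $((j_1,f_1),(j_2,f_2),\dots,(j_L,f_L)) \in (\{1,\dots,m\} \times \{2,3,4,\dots\})^L$ for some $L \in \mathbb{N}$ such that $\prod_{l:\, j_l = j} f_l = a_j$ for every $j \in \{1,\dots,m\}$ and $j_l \ne j_{l-1}$ for all $l \in \{2,\dots,L\}$. Arithmetic functions are maps $\mathbb{N}\to\mathbb{C}$ with Dirichlet convolution $(f*g)(n) = \sum_{n_1 n_2 = n} f(n_1)g(n_2)$; $f^{*j}$ is the $j$-fold convolution power, $f^{*0} = e$ with $e(n) = \delta_{n,1}$; $1$ is the constant function $1$ and $\mu$ the Möbius function. For $j \in \mathbb{N}_0$, $c_j^{(-j)} = (1-e)^{*j} * \mu^{*j}$; equivalently $c_j^{(-j)}(n)$ equals $(-1)^{\Omega(n)+j}$ times the number of ordered factorisations of $n$ into $j$ square-free factors each $>1$, where $\Omega(n)$ is the number of prime factors of $n$ counted with multiplicity. For $l \in \mathbb{N}^m$, $|l| = l_1+\dots+l_m$ and $\binom{|l|}{l} = |l|!/(l_1!\cdots l_m!)$. *)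

theory Defs
  imports "HOL-Analysis.Infinite_Sum" "HOL-Computational_Algebra.Squarefree" "HOL-Library.FuncSet"
begin

(* Throughout, the positive integers are the nonzero elements of type nat. Arithmetic functions
   are total on nat, but their value at 0 never influences values at positive arguments. *)

type_synonym arith_fun = "nat \<Rightarrow> complex"

(* Intended for n > 0; at n = 0 the index set is infinite and the sum is the default value 0. *)
definition dirichlet_conv :: "arith_fun \<Rightarrow> arith_fun \<Rightarrow> arith_fun" where
  "dirichlet_conv f g n = (\<Sum>(n1, n2) \<in> {(n1, n2). n1 * n2 = n}. f n1 * g n2)"

definition dirichlet_unit :: arith_fun where
  "dirichlet_unit n = (if n = 1 then 1 else 0)"

primrec dirichlet_power :: "arith_fun \<Rightarrow> nat \<Rightarrow> arith_fun" where
  "dirichlet_power f 0 = dirichlet_unit"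
| "dirichlet_power f (Suc j) = dirichlet_conv f (dirichlet_power f j)"

definition moebius_mu :: arith_fun where
  "moebius_mu n = (if squarefree n then (- 1) ^ card (prime_factors n) else 0)"

(* The function c_j^{(-j)}: the j-fold convolution power of 1 - e convolved with that of the
   Moebius function. *)
definition assoc_divisor_neg :: "nat \<Rightarrow> arith_fun" where
  "assoc_divisor_neg j =
     dirichlet_conv (dirichlet_power (\<lambda>n. 1 - dirichlet_unit n) j) (dirichlet_power moebius_mu j)"

(* A tuple ((j_1, f_1), ..., (j_L, f_L)) is a list of pairs, indexed from 0 instead of 1.
   L is a positive integer, so the list is nonempty. *)
definition joint_ordered_factorisations :: "nat \<Rightarrow> (nat \<Rightarrow> nat) \<Rightarrow> (nat \<times> nat) list set" where
  "joint_ordered_factorisations m a =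
     {xs. xs \<noteq> [] \<and> set xs \<subseteq> {1..m} \<times> {2..} \<and>
          (\<forall>j \<in> {1..m}. (\<Prod>i | i < length xs \<and> fst (xs ! i) = j. snd (xs ! i)) = a j) \<and>
          (\<forall>i. Suc i < length xs \<longrightarrow> fst (xs ! Suc i) \<noteq> fst (xs ! i))}"

definition multinomial :: "nat \<Rightarrow> (nat \<Rightarrow> nat) \<Rightarrow> complex" where
  "multinomial m l = fact (\<Sum>j = 1..m. l j) / (\<Prod>j = 1..m. fact (l j))"

end

theory Submission
  imports Defs
begin

text \<open>Let \<open>F(a)\<close> count the joint factorisations of \<open>a\<close> and \<open>F\<^sub>j(a)\<close> those whose first factor lies in
  component \<open>j\<close>. Splitting off the first factor gives \<open>F\<^sub>j = (1 - e) * (F - F\<^sub>j)\<close>, the convolution being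
  taken in the \<open>j\<close>-th variable. Moebius inversion of \<open>1 * F\<^sub>j = (1 - e) * F\<close> yields \<open>F\<^sub>j = g * F\<close> with
  \<open>g = (1 - e) * \<mu>\<close>, so \<open>F\<close> is the indicator of \<open>(1, \<dots>, 1)\<close> plus the sum over \<open>j\<close> of \<open>g\<close> convolved with \<open>F\<close> in the
  \<open>j\<close>-th variable. Since \<open>g(1) = 0\<close>, this recursion determines \<open>F\<close>, and the multinomial sum over the
  convolution powers of \<open>g\<close>, which are the functions \<open>c\<^sub>l\<^bsup>(-l)\<^esup>\<close>, satisfies it as well.\<close>

section \<open>Dirichlet convolution\<close>

text \<open>Settling the argument 0 allows commutativity and associativity to be stated as
  equalities of functions and used for rewriting.\<close>

lemma dirichlet_conv_0 [simp]: "dirichlet_conv f g 0 = 0"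
proof -
  have "range (\<lambda>k::nat. (0::nat, k)) \<subseteq> {(n1, n2). n1 * n2 = 0}" by auto
  moreover have "infinite (range (\<lambda>k::nat. (0::nat, k)))"
    by (simp add: finite_image_iff inj_on_def)
  ultimately have "infinite {(n1::nat, n2::nat). n1 * n2 = 0}"
    using finite_subset by blast
  then show ?thesis unfolding dirichlet_conv_def by (rule sum.infinite)
qed

lemma dirichlet_conv_dvd:
  assumes "n > 0"
  shows "dirichlet_conv f g n = (\<Sum>d | d dvd n. f d * g (n div d))"
  unfolding dirichlet_conv_def
  by (rule sum.reindex_bij_witness[where j = fst and i = "\<lambda>d. (d, n div d)"]) (use assms in auto)

lemma dirichlet_conv_cong:
  assumes "\<And>k. k > 0 \<Longrightarrow> f k = f' k" "\<And>k. k > 0 \<Longrightarrow> g k = g' k"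
  shows "dirichlet_conv f g = dirichlet_conv f' g'"
proof
  fix n
  show "dirichlet_conv f g n = dirichlet_conv f' g' n"
  proof (cases "n = 0")
    case False
    then show ?thesis unfolding dirichlet_conv_def
      by (intro sum.cong) (auto simp: assms)
  qed simp
qed

lemma dirichlet_conv_commute: "dirichlet_conv f g = dirichlet_conv g f"
  unfolding dirichlet_conv_def fun_eq_iff
  by (intro allI sum.reindex_bij_witness[where j = prod.swap and i = prod.swap])
    (auto simp: mult.commute)

lemma finite_factor_pairs: "n > 0 \<Longrightarrow> finite {(n1::nat, n2). n1 * n2 = n}"
  by (rule finite_subset[where B = "{..n} \<times> {..n}"]) (auto)

lemma dirichlet_conv_assoc:
  "dirichlet_conv (dirichlet_conv f g) h = dirichlet_conv f (dirichlet_conv g h)"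
proof
  fix n
  let ?P = "\<lambda>n. {(n1::nat, n2). n1 * n2 = n}"
  show "dirichlet_conv (dirichlet_conv f g) h n = dirichlet_conv f (dirichlet_conv g h) n"
  proof (cases "n = 0")
    case False
    then have fin: "finite (?P n)" "\<forall>x\<in>?P n. finite (?P (fst x))" "\<forall>x\<in>?P n. finite (?P (snd x))"
      using finite_factor_pairs by auto
    have "dirichlet_conv (dirichlet_conv f g) h n
        = (\<Sum>x\<in>?P n. \<Sum>y\<in>?P (fst x). f (fst y) * g (snd y) * h (snd x))"
      unfolding dirichlet_conv_def by (simp add: case_prod_unfold sum_distrib_right)
    also have "\<dots> = (\<Sum>(x, y)\<in>(SIGMA x:?P n. ?P (fst x)). f (fst y) * g (snd y) * h (snd x))"
      using fin by (subst sum.Sigma) auto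
    also have "\<dots> = (\<Sum>(x, y)\<in>(SIGMA x:?P n. ?P (snd x)). f (fst x) * (g (fst y) * h (snd y)))"
      \<comment> \<open>Both index sets describe factorisations of \<open>n\<close> into three
        factors: on the left \<open>x\<close> splits off the last factor, on the right the first
        one. The witnesses regroup the triple.\<close>
      by (rule sum.reindex_bij_witness
          [where j = "\<lambda>((x1, x2), (y1, y2)). ((y1, y2 * x2), (y2, x2))"
             and i = "\<lambda>((x1, x2), (y1, y2)). ((x1 * y1, y2), (x1, y1))"]) auto
    also have "\<dots> = (\<Sum>x\<in>?P n. \<Sum>y\<in>?P (snd x). f (fst x) * (g (fst y) * h (snd y)))"
      using fin by (subst sum.Sigma) auto
    also have "\<dots> = dirichlet_conv f (dirichlet_conv g h) n"
      unfolding dirichlet_conv_def by (simp add: case_prod_unfold sum_distrib_left)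
    finally show ?thesis .
  qed simp
qed

lemma dirichlet_conv_left_commute:
  "dirichlet_conv f (dirichlet_conv g h) = dirichlet_conv g (dirichlet_conv f h)"
  by (metis dirichlet_conv_assoc dirichlet_conv_commute)

lemmas dirichlet_conv_ac =
  dirichlet_conv_assoc dirichlet_conv_commute dirichlet_conv_left_commute

text \<open>The unit law needs \<open>n > 0\<close>: at 0 the convolution is 0, whereas
  \<open>f 0\<close> is arbitrary.\<close>

lemma dirichlet_conv_unit_left: "n > 0 \<Longrightarrow> dirichlet_conv dirichlet_unit f n = f n"
proof -
  assume n: "n > 0"
  have "dirichlet_conv dirichlet_unit f n = (\<Sum>d | d dvd n. if d = 1 then f n else 0)"
    unfolding dirichlet_conv_dvd[OF n] by (intro sum.cong) (auto simp: dirichlet_unit_def)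
  also have "\<dots> = f n" using n by (subst sum.delta) auto
  finally show ?thesis .
qed

lemma dirichlet_power_conv:
  "dirichlet_conv (dirichlet_power f j) (dirichlet_power g j) = dirichlet_power (dirichlet_conv f g) j"
proof (induction j)
  case 0
  have "dirichlet_conv dirichlet_unit dirichlet_unit n = dirichlet_unit n" for n
    by (cases "n = 0") (simp_all add: dirichlet_conv_unit_left, simp add: dirichlet_unit_def)
  then show ?case by auto
next
  case (Suc j)
  have "dirichlet_conv (dirichlet_conv f F) (dirichlet_conv g G)
      = dirichlet_conv (dirichlet_conv f g) (dirichlet_conv F G)" for F G
    by (simp add: dirichlet_conv_ac)
  then show ?case by (simp add: Suc)
qed

text \<open>Since \<open>f\<close> vanishes at 1, a nonzero term has \<open>k\<close> factors that
  are all at least 2, so its argument is at least \<open>2 ^ k\<close>. The weaker bound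
  \<open>k + 1\<close> suffices for truncating the multinomial sum.\<close>

lemma dirichlet_power_eq_0:
  assumes "f 1 = 0" "n > 0" "n < k + 1"
  shows "dirichlet_power f k n = 0"
  using assms(2,3)
proof (induction k arbitrary: n)
  case (Suc k)
  have "f d * dirichlet_power f k (n div d) = 0" if "d dvd n" for d
  proof (cases "d = 1")
    case False
    with that Suc.prems have "n div d > 0" "n div d < n"
      by auto
    then show ?thesis using Suc by auto
  qed (use assms(1) in simp)
  then show ?case using Suc.prems by (auto simp: dirichlet_conv_dvd intro!: sum.neutral)
qed simp

section \<open>Moebius inversion\<close>

lemma moebius_mu_prime_mult:
  assumes "prime p" "\<not> p dvd d" "squarefree d"
  shows "squarefree (p * d)" "moebius_mu (p * d) = - moebius_mu d"
proof -
  have cop: "coprime p d" using assms by (simp add: prime_imp_coprime)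
  show sq: "squarefree (p * d)"
    using assms cop by (simp add: squarefree_mult_coprime squarefree_prime)
  have "d \<noteq> 0" using assms(2) by (metis dvd_0_right)
  then have "prime_factors (p * d) = insert p (prime_factors d)"
    using assms by (auto simp: prime_factors_product prime_prime_factors)
  moreover have "p \<notin> prime_factors d" using assms by auto
  ultimately show "moebius_mu (p * d) = - moebius_mu d"
    using sq assms by (simp add: moebius_mu_def)
qed

text \<open>For a prime \<open>p\<close> dividing \<open>n\<close>, multiplication by
  \<open>p\<close> is a sign-reversing bijection from the squarefree divisors prime to
  \<open>p\<close> onto those divisible by \<open>p\<close>, so the two halves cancel.\<close>

lemma sum_moebius_mu:
  assumes "n > 0"
  shows "(\<Sum>d | d dvd n. moebius_mu d) = dirichlet_unit n"
proof (cases "n = 1")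
  case True
  then show ?thesis by (simp add: moebius_mu_def dirichlet_unit_def)
next
  case False
  then obtain p where p: "prime p" "p dvd n" using prime_factor_nat by blast
  let ?D = "{d. d dvd n \<and> squarefree d}"
  have fin: "finite {d. d dvd n}" using assms by simp
  have "(\<Sum>d | d dvd n. moebius_mu d) = sum moebius_mu ?D"
    by (rule sum.mono_neutral_right) (use fin in \<open>auto simp: moebius_mu_def\<close>)
  also have "?D = {d\<in>?D. \<not> p dvd d} \<union> {d\<in>?D. p dvd d}" by auto
  also have "sum moebius_mu \<dots> = sum moebius_mu {d\<in>?D. \<not> p dvd d} + sum moebius_mu {d\<in>?D. p dvd d}"
    by (rule sum.union_disjoint) (use fin in auto)
  also have "sum moebius_mu {d\<in>?D. p dvd d} = (\<Sum>d | d \<in> ?D \<and> \<not> p dvd d. - moebius_mu d)"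
  proof (rule sum.reindex_bij_witness[where i = "\<lambda>d. p * d" and j = "\<lambda>d. d div p"])
    fix d assume "d \<in> {d\<in>?D. p dvd d}"
    then obtain e where e: "d = p * e" "d dvd n" "squarefree d" by auto
    \<comment> \<open>Otherwise the square of \<open>p\<close> would divide the squarefree number
      \<open>d\<close>.\<close>
    have ne: "\<not> p dvd e"
      using e p squarefreeD[of d p] by (auto simp: power2_eq_square not_prime_unit)
    have "squarefree e" using e squarefree_mono by (metis dvd_triv_right)
    then show "p * (d div p) = d" "d div p \<in> {d\<in>?D. \<not> p dvd d}" "- moebius_mu (d div p) = moebius_mu d"
      using e ne p by (auto simp: moebius_mu_prime_mult prime_gt_0_nat intro: dvd_trans)
  next
    fix d assume d: "d \<in> {d\<in>?D. \<not> p dvd d}"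
    then have "coprime p d" using p by (simp add: prime_imp_coprime)
    then have "p * d dvd n" using d p by (simp add: divides_mult)
    then show "p * d div p = d" "p * d \<in> {d\<in>?D. p dvd d}"
      using d p by (auto simp: moebius_mu_prime_mult prime_gt_0_nat)
  qed
  finally show ?thesis using False by (simp add: sum_negf dirichlet_unit_def)
qed

lemma dirichlet_conv_moebius_one: "dirichlet_conv moebius_mu (\<lambda>_. 1) = dirichlet_unit"
proof
  fix n show "dirichlet_conv moebius_mu (\<lambda>_. 1) n = dirichlet_unit n"
    by (cases "n = 0") (simp_all add: dirichlet_conv_dvd sum_moebius_mu, simp add: dirichlet_unit_def)
qed

text \<open>In terms of Dirichlet series this is the quotient \<open>(zeta - 1) / zeta\<close>; at
  positive arguments it equals \<open>e - \<mu>\<close>.\<close>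

definition quotient_kernel :: arith_fun where
  "quotient_kernel = dirichlet_conv (\<lambda>n. 1 - dirichlet_unit n) moebius_mu"

lemma assoc_divisor_neg_eq: "assoc_divisor_neg j = dirichlet_power quotient_kernel j"
  by (simp add: assoc_divisor_neg_def quotient_kernel_def dirichlet_power_conv)

lemma quotient_kernel_1: "quotient_kernel 1 = 0"
  by (simp add: quotient_kernel_def dirichlet_conv_dvd dirichlet_unit_def)

text \<open>Convolving the hypothesis with \<open>moebius_mu\<close> cancels the constant function 1
  on the left and turns \<open>1 - e\<close> into the kernel on the right.\<close>

lemma moebius_solve:
  assumes "\<And>n. n > 0 \<Longrightarrow>
    dirichlet_conv (\<lambda>_. 1) f n = dirichlet_conv (\<lambda>n. 1 - dirichlet_unit n) h n"
  assumes "n > 0"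
  shows "f n = dirichlet_conv quotient_kernel h n"
proof -
  have "f n = dirichlet_conv (dirichlet_conv moebius_mu (\<lambda>_. 1)) f n"
    using assms(2) by (simp add: dirichlet_conv_moebius_one dirichlet_conv_unit_left)
  also have "\<dots> = dirichlet_conv moebius_mu (dirichlet_conv (\<lambda>n. 1 - dirichlet_unit n) h) n"
    unfolding dirichlet_conv_assoc
    by (rule fun_cong[OF dirichlet_conv_cong]) (use assms(1) in auto)
  also have "\<dots> = dirichlet_conv quotient_kernel h n"
    unfolding quotient_kernel_def by (simp only: dirichlet_conv_ac)
  finally show ?thesis .
qed

section \<open>Joint factorisations\<close>

text \<open>A product along the list, rather than over positions, so that removing the head is a
  simplification step.\<close>

definition component_prod :: "nat \<Rightarrow> (nat \<times> nat) list \<Rightarrow> nat" where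
  "component_prod j xs = (\<Prod>p\<leftarrow>xs. if fst p = j then snd p else 1)"

lemma component_prod_simps [simp]:
  "component_prod j [] = 1"
  "component_prod j (p # xs) = (if fst p = j then snd p else 1) * component_prod j xs"
  by (simp_all add: component_prod_def)

lemma component_prod_nth:
  "(\<Prod>i | i < length xs \<and> fst (xs ! i) = j. snd (xs ! i)) = component_prod j xs"
proof -
  have "component_prod j xs = (\<Prod>i<length xs. if fst (xs ! i) = j then snd (xs ! i) else 1)"
    by (simp add: component_prod_def prod.list_conv_set_nth atLeast0LessThan)
  also have "\<dots> = (\<Prod>i\<in>{..<length xs} \<inter> {i. fst (xs ! i) = j}. snd (xs ! i))"
    by (subst prod.inter_restrict) auto
  also have "{..<length xs} \<inter> {i. fst (xs ! i) = j} = {i. i < length xs \<and> fst (xs ! i) = j}"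
    by auto
  finally show ?thesis ..
qed

text \<open>In contrast to the joint ordered factorisations, the empty list and components equal to 1
  are admitted; this is what makes the recursion close up.\<close>

definition joint_facts :: "nat \<Rightarrow> (nat \<Rightarrow> nat) \<Rightarrow> (nat \<times> nat) list set" where
  "joint_facts m a =
     {xs. set xs \<subseteq> {1..m} \<times> {2..} \<and> (\<forall>j\<in>{1..m}. component_prod j xs = a j) \<and>
          distinct_adj (map fst xs)}"

definition joint_facts_from :: "nat \<Rightarrow> (nat \<Rightarrow> nat) \<Rightarrow> nat \<Rightarrow> (nat \<times> nat) list set" where
  "joint_facts_from m a j = {xs \<in> joint_facts m a. xs \<noteq> [] \<and> fst (hd xs) = j}"

text \<open>The two sets could differ only in the empty list, whose component products are 1;
  \<open>a 1 \<ge> 2\<close> rules it out.\<close>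

lemma joint_ordered_factorisations_eq:
  assumes "m \<ge> 1" "\<forall>j\<in>{1..m}. a j \<ge> 2"
  shows "joint_ordered_factorisations m a = joint_facts m a"
proof -
  have "1 \<in> {1..m}" using assms(1) by simp
  moreover from this have "a 1 \<noteq> 1" using assms(2) by fastforce
  ultimately have "\<not> (\<forall>j\<in>{1..m}. component_prod j [] = a j)"
    by (metis component_prod_simps(1))
  moreover have "(\<forall>i. Suc i < length xs \<longrightarrow> fst (xs ! Suc i) \<noteq> fst (xs ! i)) \<longleftrightarrow>
      distinct_adj (map fst xs)" for xs :: "(nat \<times> nat) list"
    unfolding distinct_adj_conv_nth length_map less_diff_conv
    by (metis Suc_eq_plus1 Suc_lessD nth_map)
  ultimately show ?thesis
    unfolding joint_ordered_factorisations_def joint_facts_def component_prod_nth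
    by (intro Collect_cong) metis
qed

section \<open>Splitting off the first factor\<close>

lemma joint_facts_decomp:
  "joint_facts m a = (if \<forall>j\<in>{1..m}. a j = 1 then {[]} else {}) \<union> (\<Union>j\<in>{1..m}. joint_facts_from m a j)"
  (is "?L = ?R")
proof (intro equalityI subsetI)
  fix xs assume "xs \<in> ?L"
  then show "xs \<in> ?R"
    by (cases xs) (auto simp: joint_facts_def joint_facts_from_def)
next
  fix xs assume "xs \<in> ?R"
  then show "xs \<in> ?L"
    by (auto simp: joint_facts_def joint_facts_from_def split: if_splits)
qed

text \<open>Removing the head \<open>(j, d)\<close> divides \<open>a j\<close> by \<open>d\<close>.
  The adjacency condition says exactly that the tail does not start in component \<open>j\<close>,
  hence the set difference; an empty tail survives it.\<close>

lemma joint_facts_from_eq: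
  assumes "j \<in> {1..m}" "a j > 0"
  shows "joint_facts_from m a j =
    (\<Union>d\<in>{d. d dvd a j \<and> 2 \<le> d}. (#) (j, d) `
       (joint_facts m (a(j := a j div d)) - joint_facts_from m (a(j := a j div d)) j))"
  (is "?L = ?R")
proof (intro equalityI subsetI)
  fix xs assume xs: "xs \<in> ?L"
  then obtain d ys where *: "xs = (j, d) # ys"
    by (cases xs) (auto simp: joint_facts_from_def)
  have d: "2 \<le> d" using xs * by (auto simp: joint_facts_from_def joint_facts_def)
  have "component_prod j xs = a j"
    using xs assms(1) by (simp add: joint_facts_from_def joint_facts_def)
  then have prod: "d * component_prod j ys = a j" by (simp add: *)
  have "component_prod i ys = (a(j := a j div d)) i" if "i \<in> {1..m}" for i
  proof (cases "i = j")
    case False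
    have "component_prod i xs = a i" using xs that by (simp add: joint_facts_from_def joint_facts_def)
    then show ?thesis using False by (simp add: *)
  qed (use d in \<open>simp add: prod[symmetric]\<close>)
  then have "ys \<in> joint_facts m (a(j := a j div d))"
    using xs by (auto simp: joint_facts_from_def joint_facts_def * distinct_adj_Cons)
  moreover have "ys \<notin> joint_facts_from m (a(j := a j div d)) j"
    using xs by (cases ys) (auto simp: joint_facts_from_def joint_facts_def *)
  ultimately have "ys \<in> joint_facts m (a(j := a j div d)) - joint_facts_from m (a(j := a j div d)) j"
    by blast
  moreover have "d dvd a j" using prod by (metis dvd_triv_left)
  ultimately show "xs \<in> ?R" using * d by blast
next
  fix xs assume "xs \<in> ?R"
  then obtain d ys where d: "d dvd a j" "2 \<le> d" and xs: "xs = (j, d) # ys"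
    and ys: "ys \<in> joint_facts m (a(j := a j div d))" "ys \<notin> joint_facts_from m (a(j := a j div d)) j"
    by auto
  have "component_prod i xs = a i" if "i \<in> {1..m}" for i
    using that ys(1) xs d by (auto simp: joint_facts_def)
  moreover have "set xs \<subseteq> {1..m} \<times> {2..}"
  proof -
    have "set ys \<subseteq> {1..m} \<times> {2..}" using ys(1) unfolding joint_facts_def by blast
    then show ?thesis using xs d(2) assms(1) by simp
  qed
  moreover have "distinct_adj (map fst xs)"
  proof -
    have "distinct_adj (map fst ys)" using ys(1) unfolding joint_facts_def by blast
    moreover have "ys = [] \<or> fst (hd ys) \<noteq> j"
      using ys unfolding joint_facts_from_def by blast
    ultimately show ?thesis by (auto simp: xs distinct_adj_Cons hd_map)
  qed
  ultimately have "xs \<in> joint_facts m a" unfolding joint_facts_def by blast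
  then show "xs \<in> ?L" by (simp add: joint_facts_from_def xs)
qed

text \<open>Removing a first factor \<open>d \<ge> 2\<close> strictly lowers the sum of the
  components, so the decomposition supports an induction on that sum.\<close>

lemma finite_joint_facts: "\<forall>j\<in>{1..m}. a j > 0 \<Longrightarrow> finite (joint_facts m a)"
proof (induction "\<Sum>j=1..m. a j" arbitrary: a rule: less_induct)
  case less
  have "finite (joint_facts_from m a j)" if j: "j \<in> {1..m}" for j
  proof -
    have "finite (joint_facts m (a(j := a j div d)))" if d: "d dvd a j" "2 \<le> d" for d
    proof (rule less.hyps)
      have "a j > 0" using less.prems j by blast
      with d have lt: "a j div d < a j" "a j div d > 0" by auto
      show "sum (a(j := a j div d)) {1..m} < sum a {1..m}"
        by (rule sum_strict_mono_ex1) (use lt j in auto)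
      show "\<forall>i\<in>{1..m}. 0 < (a(j := a j div d)) i" using less.prems lt by auto
    qed
    moreover have "finite {d. d dvd a j \<and> 2 \<le> d}" using less.prems j by auto
    ultimately show ?thesis using less.prems j by (subst joint_facts_from_eq) auto
  qed
  then show ?case by (subst joint_facts_decomp) auto
qed

lemma finite_joint_facts_from: "\<forall>j\<in>{1..m}. a j > 0 \<Longrightarrow> finite (joint_facts_from m a j)"
  using finite_joint_facts[of m a] by (auto simp: joint_facts_from_def)

section \<open>Counting identities\<close>

lemma card_joint_facts:
  assumes "\<forall>j\<in>{1..m}. a j > 0"
  shows "card (joint_facts m a) =
    (if \<forall>j\<in>{1..m}. a j = 1 then 1 else 0) + (\<Sum>j=1..m. card (joint_facts_from m a j))"
proof -
  have "card (\<Union>j\<in>{1..m}. joint_facts_from m a j) = (\<Sum>j=1..m. card (joint_facts_from m a j))"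
    using finite_joint_facts_from[OF assms]
    by (intro card_UN_disjoint) (auto simp: joint_facts_from_def)
  moreover have "[] \<notin> (\<Union>j\<in>{1..m}. joint_facts_from m a j)" by (auto simp: joint_facts_from_def)
  ultimately show ?thesis
    using finite_joint_facts_from[OF assms] by (subst joint_facts_decomp) auto
qed

text \<open>This is \<open>F\<^sub>j = (1 - e) * (F - F\<^sub>j)\<close>. Passing to complex numbers
  is harmless because each subtracted set is contained in the other, so no difference of naturals is
  truncated.\<close>

lemma card_joint_facts_from:
  assumes "\<forall>i\<in>{1..m}. a i > 0" "j \<in> {1..m}"
  shows "of_nat (card (joint_facts_from m a j)) =
    (\<Sum>d | d dvd a j \<and> 2 \<le> d. of_nat (card (joint_facts m (a(j := a j div d)))) -
       (of_nat (card (joint_facts_from m (a(j := a j div d)) j)) :: complex))"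
proof -
  let ?D = "{d. d dvd a j \<and> 2 \<le> d}"
  let ?b = "\<lambda>d. a(j := a j div d)"
  have aj: "a j > 0" using assms by blast
  have fin: "finite (joint_facts m (?b d))" if "d \<in> ?D" for d
  proof (rule finite_joint_facts)
    have "a j div d > 0" using that aj by auto
    then show "\<forall>i\<in>{1..m}. ?b d i > 0" using assms(1) by auto
  qed
  have finD: "finite ?D" using aj by simp
  have "card (joint_facts_from m a j) =
      (\<Sum>d\<in>?D. card ((#) (j, d) ` (joint_facts m (?b d) - joint_facts_from m (?b d) j)))"
    unfolding joint_facts_from_eq[where a = a, OF assms(2) aj]
    by (rule card_UN_disjoint) (use finD fin in auto)
  also have "\<dots> = (\<Sum>d\<in>?D. card (joint_facts m (?b d)) - card (joint_facts_from m (?b d) j))"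
    using fin by (intro sum.cong refl, subst card_image)
      (auto intro!: card_Diff_subset intro: finite_subset simp: joint_facts_from_def)
  finally have card_eq: "card (joint_facts_from m a j) = \<dots>" .
  show ?thesis
    unfolding card_eq of_nat_sum
  proof (rule sum.cong[OF refl])
    fix d assume "d \<in> ?D"
    then have "card (joint_facts_from m (?b d) j) \<le> card (joint_facts m (?b d))"
      by (intro card_mono fin) (auto simp: joint_facts_from_def)
    then show "of_nat (card (joint_facts m (?b d)) - card (joint_facts_from m (?b d) j)) =
        of_nat (card (joint_facts m (?b d))) - (of_nat (card (joint_facts_from m (?b d) j)) :: complex)"
      by (rule of_nat_diff)
  qed
qed

lemma card_joint_facts_from_conv:
  assumes "\<forall>i\<in>{1..m}. a i > 0" "j \<in> {1..m}"
  shows "of_nat (card (joint_facts_from m a j)) =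
    (\<Sum>d | d dvd a j. quotient_kernel d * of_nat (card (joint_facts m (a(j := a j div d)))))"
proof -
  \<comment> \<open>Only the \<open>j\<close>-th component varies, the others being frozen; this
    reduces the claim to inversion in one variable.\<close>
  define \<phi> :: arith_fun where "\<phi> = (\<lambda>n. of_nat (card (joint_facts_from m (a(j := n)) j)))"
  define \<psi> :: arith_fun where "\<psi> = (\<lambda>n. of_nat (card (joint_facts m (a(j := n)))))"
  have aj: "a j > 0" using assms by blast
  have "\<phi> (a j) = dirichlet_conv quotient_kernel \<psi> (a j)"
  proof (rule moebius_solve[OF _ aj])
    fix n :: nat assume n: "n > 0"
    \<comment> \<open>The divisor 1 is isolated because its term in \<open>1 * \<phi>\<close> is
      \<open>\<phi> n\<close> itself, while \<open>1 - e\<close> kills it on the other side.\<close>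
    have D: "{d. d dvd n} = insert 1 {d. d dvd n \<and> 2 \<le> d}"
    proof -
      have "d = 1 \<or> 2 \<le> d" if "d dvd n" for d using that n by (cases d) auto
      then show ?thesis by auto
    qed
    have fin: "finite {d. d dvd n \<and> 2 \<le> d}" using n by simp
    have "\<phi> n = (\<Sum>d | d dvd n \<and> 2 \<le> d. \<psi> (n div d) - \<phi> (n div d))"
      using card_joint_facts_from[of m "a(j := n)" j] assms n by (simp add: \<phi>_def \<psi>_def)
    moreover have "dirichlet_conv (\<lambda>_. 1) \<phi> n = \<phi> n + (\<Sum>d | d dvd n \<and> 2 \<le> d. \<phi> (n div d))"
      unfolding dirichlet_conv_dvd[OF n] D using fin by simp
    moreover have "dirichlet_conv (\<lambda>n. 1 - dirichlet_unit n) \<psi> n = (\<Sum>d | d dvd n \<and> 2 \<le> d. \<psi> (n div d))"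
      unfolding dirichlet_conv_dvd[OF n] D using fin
      by (simp, simp add: dirichlet_unit_def)
    ultimately show "dirichlet_conv (\<lambda>_. 1) \<phi> n = dirichlet_conv (\<lambda>n. 1 - dirichlet_unit n) \<psi> n"
      by (simp add: sum_subtractf)
  qed
  then show ?thesis using aj by (simp add: \<phi>_def \<psi>_def dirichlet_conv_dvd)
qed

section \<open>The multinomial expansion\<close>

definition weak_compositions :: "nat \<Rightarrow> nat \<Rightarrow> (nat \<Rightarrow> nat) set" where
  "weak_compositions m n = {l \<in> {1..m} \<rightarrow>\<^sub>E UNIV. (\<Sum>j=1..m. l j) = n}"

lemma finite_weak_compositions: "finite (weak_compositions m n)"
proof (rule finite_subset)
  show "weak_compositions m n \<subseteq> {1..m} \<rightarrow>\<^sub>E {..n}"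
  proof
    fix l assume l: "l \<in> weak_compositions m n"
    have "l j \<le> (\<Sum>j=1..m. l j)" if "j \<in> {1..m}" for j
      using that by (intro member_le_sum) auto
    then show "l \<in> {1..m} \<rightarrow>\<^sub>E {..n}"
      using l by (simp add: weak_compositions_def PiE_iff)
  qed
qed (simp add: finite_PiE)

text \<open>The generalised Pascal rule: words with \<open>l j\<close> letters \<open>j\<close> are
  sorted by their first letter. Each lowered coefficient is \<open>l j * n!\<close> over the product
  of the \<open>l i!\<close>, and the \<open>l j\<close> add up to \<open>n + 1\<close>.\<close>

lemma multinomial_rec:
  assumes "(\<Sum>j=1..m. l j) = Suc n"
  shows "multinomial m l = (\<Sum>j | j \<in> {1..m} \<and> l j > 0. multinomial m (l(j := l j - 1)))"
proof -
  have *: "multinomial m (l(j := l j - 1)) = of_nat (l j) * fact n / (\<Prod>i=1..m. fact (l i))"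
    if j: "j \<in> {1..m}" "l j > 0" for j
  proof -
    have "(\<Sum>i=1..m. (l(j := l j - 1)) i) = (l j - 1) + (\<Sum>i\<in>{1..m}-{j}. l i)"
      by (subst sum.remove[OF _ j(1)]) (auto intro!: sum.cong)
    moreover have "(\<Sum>i=1..m. l i) = l j + (\<Sum>i\<in>{1..m}-{j}. l i)"
      by (rule sum.remove[OF _ j(1)]) simp
    ultimately have s: "(\<Sum>i=1..m. (l(j := l j - 1)) i) = n" using assms j by simp
    have "(\<Prod>i=1..m. fact ((l(j := l j - 1)) i)) = fact (l j - 1) * (\<Prod>i\<in>{1..m}-{j}. fact (l i) :: complex)"
      by (subst prod.remove[OF _ j(1)]) (auto intro!: prod.cong)
    moreover have "(\<Prod>i=1..m. fact (l i)) = fact (l j) * (\<Prod>i\<in>{1..m}-{j}. fact (l i) :: complex)"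
      by (rule prod.remove[OF _ j(1)]) simp
    moreover have "(fact (l j) :: complex) = of_nat (l j) * fact (l j - 1)"
      using j(2) by (simp add: fact_reduce)
    ultimately show ?thesis unfolding multinomial_def s using j(2) by simp
  qed
  have "(\<Sum>j | j \<in> {1..m} \<and> l j > 0. multinomial m (l(j := l j - 1)))
      = (\<Sum>j | j \<in> {1..m} \<and> l j > 0. of_nat (l j) * fact n / (\<Prod>i=1..m. fact (l i)))"
    by (intro sum.cong refl *) auto
  also have "\<dots> = (\<Sum>j=1..m. of_nat (l j) * fact n / (\<Prod>i=1..m. fact (l i)))"
    by (rule sum.mono_neutral_left) auto
  also have "\<dots> = of_nat (\<Sum>j=1..m. l j) * fact n / (\<Prod>i=1..m. fact (l i))"
    by (simp add: sum_distrib_right sum_divide_distrib)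
  also have "\<dots> = multinomial m l" unfolding multinomial_def assms by simp
  finally show ?thesis ..
qed

text \<open>By the multinomial theorem, at positive \<open>a\<close> this is the \<open>n\<close>-th
  power of the operator summing the convolutions with \<open>g\<close> in each variable, applied to
  the indicator of the all-ones tuple.\<close>

definition multinomial_level :: "arith_fun \<Rightarrow> nat \<Rightarrow> nat \<Rightarrow> (nat \<Rightarrow> nat) \<Rightarrow> complex" where
  "multinomial_level g m n a =
     (\<Sum>l\<in>weak_compositions m n. multinomial m l * (\<Prod>j=1..m. dirichlet_power g (l j) (a j)))"

lemma multinomial_level_0:
  "multinomial_level g m 0 a = (if \<forall>j\<in>{1..m}. a j = 1 then 1 else 0)"
proof -
  have "weak_compositions m 0 = {\<lambda>j\<in>{1..m}. 0}"
    by (auto simp: weak_compositions_def PiE_iff fun_eq_iff extensional_def restrict_def)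
  then show ?thesis
    by (auto simp: multinomial_level_def multinomial_def dirichlet_unit_def)
qed

lemma multinomial_level_Suc:
  assumes "\<forall>j\<in>{1..m}. a j > 0"
  shows "multinomial_level g m (Suc n) a =
    (\<Sum>j=1..m. \<Sum>d | d dvd a j. g d * multinomial_level g m n (a(j := a j div d)))"
proof -
  let ?T = "\<lambda>l. \<Prod>j=1..m. dirichlet_power g (l j) (a j)"
  let ?W = "weak_compositions m"
  have "multinomial_level g m (Suc n) a =
      (\<Sum>l\<in>?W (Suc n). \<Sum>j | j \<in> {1..m} \<and> l j > 0. multinomial m (l(j := l j - 1)) * ?T l)"
    unfolding multinomial_level_def
    by (intro sum.cong refl, subst multinomial_rec)
      (auto simp: weak_compositions_def sum_distrib_right)
  also have "\<dots> = (\<Sum>j=1..m. \<Sum>l | l \<in> ?W (Suc n) \<and> l j > 0. multinomial m (l(j := l j - 1)) * ?T l)"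
    by (rule sum.swap_restrict) (auto simp: finite_weak_compositions)
  also have "\<dots> = (\<Sum>j=1..m. \<Sum>d | d dvd a j. g d * multinomial_level g m n (a(j := a j div d)))"
  proof (rule sum.cong[OF refl])
    fix j assume j: "j \<in> {1..m}"
    then have aj: "a j > 0" using assms by blast
    have sum_upd: "(\<Sum>i=1..m. (l(j := x)) i) = x + (\<Sum>i\<in>{1..m}-{j}. l i)" for l :: "nat \<Rightarrow> nat" and x
      by (subst sum.remove[OF _ j]) (auto intro!: sum.cong)
    have sum_rem: "(\<Sum>i=1..m. l i) = l j + (\<Sum>i\<in>{1..m}-{j}. l i)" for l :: "nat \<Rightarrow> nat"
      by (rule sum.remove[OF _ j]) simp
    have up: "k(j := Suc (k j)) \<in> ?W (Suc n)" if "k \<in> ?W n" for k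
      using that j unfolding weak_compositions_def mem_Collect_eq sum_upd sum_rem
      by (auto simp: PiE_iff extensional_def)
    have down: "l(j := l j - 1) \<in> ?W n" if "l \<in> ?W (Suc n)" "l j > 0" for l
      using that j unfolding weak_compositions_def mem_Collect_eq sum_upd sum_rem
      by (auto simp: PiE_iff extensional_def)
    have "(\<Sum>l | l \<in> ?W (Suc n) \<and> l j > 0. multinomial m (l(j := l j - 1)) * ?T l)
        = (\<Sum>k\<in>?W n. multinomial m k * ?T (k(j := Suc (k j))))"
      \<comment> \<open>Lowering entry \<open>j\<close> by one is inverted by raising it; the power
        of \<open>g\<close> in component \<open>j\<close> thereby gains one factor, which is then
        unrolled as a convolution.\<close>
      by (rule sum.reindex_bij_witness
          [where i = "\<lambda>k. k(j := Suc (k j))" and j = "\<lambda>l. l(j := l j - 1)"])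
        (use up down in \<open>auto simp del: dirichlet_power.simps\<close>)
    also have "\<dots> = (\<Sum>k\<in>?W n. \<Sum>d | d dvd a j.
        g d * (multinomial m k * (\<Prod>i=1..m. dirichlet_power g (k i) ((a(j := a j div d)) i))))"
    proof (rule sum.cong[OF refl])
      fix k
      let ?R = "\<Prod>i\<in>{1..m}-{j}. dirichlet_power g (k i) (a i)"
      have "?T (k(j := Suc (k j))) = dirichlet_conv g (dirichlet_power g (k j)) (a j) * ?R"
        by (subst prod.remove[OF _ j]) (auto intro!: prod.cong)
      moreover have "(\<Prod>i=1..m. dirichlet_power g (k i) ((a(j := a j div d)) i)) =
          dirichlet_power g (k j) (a j div d) * ?R" for d
        by (subst prod.remove[OF _ j]) (auto intro!: prod.cong)
      ultimately show "multinomial m k * ?T (k(j := Suc (k j))) = (\<Sum>d | d dvd a j.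
          g d * (multinomial m k * (\<Prod>i=1..m. dirichlet_power g (k i) ((a(j := a j div d)) i))))"
        unfolding dirichlet_conv_dvd[OF aj]
        by (simp add: sum_distrib_left sum_distrib_right mult_ac)
    qed
    also have "\<dots> = (\<Sum>d | d dvd a j. g d * multinomial_level g m n (a(j := a j div d)))"
      by (subst sum.swap) (simp add: multinomial_level_def sum_distrib_left)
    finally show "(\<Sum>l | l \<in> ?W (Suc n) \<and> l j > 0. multinomial m (l(j := l j - 1)) * ?T l) = \<dots>" .
  qed
  finally show ?thesis .
qed

text \<open>The counts and the truncated sum obey the same recursion. The bound \<open>N\<close>
  drives the induction: a divisor \<open>d \<ge> 2\<close> lowers the sum of the components, so the
  quotient tuple satisfies the bound for the predecessor. For \<open>N = 0\<close> the bound is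
  contradictory.\<close>

lemma card_joint_facts_expansion:
  assumes "\<forall>j\<in>{1..m}. a j > 0" "(\<Sum>j=1..m. a j) < N"
  shows "of_nat (card (joint_facts m a)) = (\<Sum>n<N. multinomial_level quotient_kernel m n a)"
  using assms
proof (induction N arbitrary: a)
  case (Suc N)
  let ?g = quotient_kernel
  have step: "?g d * of_nat (card (joint_facts m (a(j := a j div d)))) =
      ?g d * (\<Sum>n<N. multinomial_level ?g m n (a(j := a j div d)))"
    if j: "j \<in> {1..m}" and d: "d dvd a j" for j d
  proof (cases "d = 1")
    case True
    then show ?thesis by (simp add: quotient_kernel_1[simplified])
  next
    case False
    have "a j > 0" using Suc.prems j by blast
    with d False have lt: "a j div d < a j" "a j div d > 0" by auto
    have "sum (a(j := a j div d)) {1..m} < sum a {1..m}"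
      by (rule sum_strict_mono_ex1) (use lt j in auto)
    then show ?thesis using Suc.prems lt by (subst Suc.IH) auto
  qed
  have "of_nat (card (joint_facts m a)) = multinomial_level ?g m 0 a +
      (\<Sum>j=1..m. \<Sum>d | d dvd a j. ?g d * of_nat (card (joint_facts m (a(j := a j div d)))))"
    using Suc.prems
    by (simp add: card_joint_facts multinomial_level_0 card_joint_facts_from_conv)
  also have "\<dots> = multinomial_level ?g m 0 a +
      (\<Sum>j=1..m. \<Sum>d | d dvd a j. ?g d * (\<Sum>n<N. multinomial_level ?g m n (a(j := a j div d))))"
    by (intro arg_cong2[where f = "(+)"] refl sum.cong step) auto
  also have "\<dots> = multinomial_level ?g m 0 a +
      (\<Sum>n<N. \<Sum>j=1..m. \<Sum>d | d dvd a j. ?g d * multinomial_level ?g m n (a(j := a j div d)))"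
    by (simp add: sum_distrib_left sum.swap[of _ "{..<N}"])
  also have "\<dots> = multinomial_level ?g m 0 a + (\<Sum>n<N. multinomial_level ?g m (Suc n) a)"
    by (simp add: multinomial_level_Suc[OF Suc.prems(1)])
  also have "\<dots> = (\<Sum>n<Suc N. multinomial_level ?g m n a)"
    by (rule sum.lessThan_Suc_shift[symmetric])
  finally show ?case .
qed simp

theorem theorem4:
  fixes m :: nat and a :: "nat \<Rightarrow> nat"
  assumes "m \<ge> 1" and "\<forall>j \<in> {1..m}. a j \<ge> 2"
  shows "finite (joint_ordered_factorisations m a) \<and>
         finite {l \<in> {1..m} \<rightarrow>\<^sub>E {1..}.
           multinomial m l * (\<Prod>j = 1..m. assoc_divisor_neg (l j) (a j)) \<noteq> 0} \<and>
         of_nat (card (joint_ordered_factorisations m a)) =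
         (\<Sum>\<^sub>\<infinity>l \<in> {1..m} \<rightarrow>\<^sub>E {1..}.
           multinomial m l * (\<Prod>j = 1..m. assoc_divisor_neg (l j) (a j)))"
proof -
  let ?t = "\<lambda>l. multinomial m l * (\<Prod>j = 1..m. assoc_divisor_neg (l j) (a j))"
  define N where "N = Suc (\<Sum>j=1..m. a j)"
  \<comment> \<open>A finite set of tuples, zero entries included, on which the expansion is
    available; it contains every positive tuple with a nonzero term.\<close>
  define S where "S = (\<Union>n<N. weak_compositions m n)"
  have pos: "\<forall>j\<in>{1..m}. a j > 0" using assms(2) by force
  have finS: "finite S" by (simp add: S_def finite_weak_compositions)
  have S_iff: "l \<in> S \<longleftrightarrow> l \<in> {1..m} \<rightarrow>\<^sub>E UNIV \<and> (\<Sum>j=1..m. l j) < N" for l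
    by (auto simp: S_def weak_compositions_def)
  \<comment> \<open>The lower bound holds because the zeroth power is the unit, which vanishes at
    \<open>a j \<noteq> 1\<close>; so tuples with a zero entry contribute nothing. The upper bound
    makes the support finite.\<close>
  have bound: "1 \<le> l j \<and> l j \<le> a j" if "?t l \<noteq> 0" "j \<in> {1..m}" for l j
  proof -
    have nz: "dirichlet_power quotient_kernel (l j) (a j) \<noteq> 0"
      using that by (auto simp: assoc_divisor_neg_eq)
    have "l j \<noteq> 0"
    proof
      assume "l j = 0"
      moreover have "a j \<noteq> 1" using assms(2) that(2) by fastforce
      ultimately show False using nz by (simp add: dirichlet_unit_def)
    qed
    moreover have "l j \<le> a j"
      using nz dirichlet_power_eq_0[of quotient_kernel "a j" "l j"] quotient_kernel_1 pos that(2) by fastforce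
    ultimately show ?thesis by simp
  qed
  have in_S: "l \<in> S" if "l \<in> {1..m} \<rightarrow>\<^sub>E {1..}" "?t l \<noteq> 0" for l
  proof -
    have "(\<Sum>j=1..m. l j) \<le> (\<Sum>j=1..m. a j)" by (rule sum_mono) (use bound that in blast)
    then show ?thesis using that by (auto simp: S_iff N_def PiE_iff)
  qed
  \<comment> \<open>Neither index set contains the other, but all terms on their symmetric
    difference are 0.\<close>
  have "(\<Sum>\<^sub>\<infinity>l \<in> {1..m} \<rightarrow>\<^sub>E {1..}. ?t l) = (\<Sum>\<^sub>\<infinity>l\<in>S. ?t l)"
  proof (rule infsum_cong_neutral)
    fix l assume "l \<in> ({1..m} \<rightarrow>\<^sub>E {1..}) - S"
    then show "?t l = 0" using in_S by blast
  next
    fix l assume l: "l \<in> S - ({1..m} \<rightarrow>\<^sub>E {1..})"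
    show "?t l = 0"
    proof (rule ccontr)
      assume "?t l \<noteq> 0"
      then have "l \<in> {1..m} \<rightarrow>\<^sub>E {1..}" using bound[of l] l by (auto simp: S_iff PiE_iff)
      then show False using l by blast
    qed
  qed simp
  also have "\<dots> = (\<Sum>l\<in>S. ?t l)" using finS by simp
  also have "\<dots> = (\<Sum>n<N. multinomial_level quotient_kernel m n a)"
    unfolding S_def multinomial_level_def assoc_divisor_neg_eq
    by (rule sum.UNION_disjoint) (auto simp: finite_weak_compositions, auto simp: weak_compositions_def)
  also have "\<dots> = of_nat (card (joint_facts m a))"
    by (rule card_joint_facts_expansion[symmetric]) (use pos in \<open>auto simp: N_def\<close>)
  finally have "of_nat (card (joint_facts m a)) = (\<Sum>\<^sub>\<infinity>l \<in> {1..m} \<rightarrow>\<^sub>E {1..}. ?t l)" ..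
  moreover have "finite {l \<in> {1..m} \<rightarrow>\<^sub>E {1..}. ?t l \<noteq> 0}"
    by (rule finite_subset[OF _ finS]) (use in_S in blast)
  ultimately show ?thesis
    unfolding joint_ordered_factorisations_eq[OF assms] using finite_joint_facts[OF pos] by blast
qed

end
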